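(* Let $\operatorname{adj}$ denote the number of adjacencies (minimal descents) of a uniformly random permutation of length $n$, and let $r\ge1$. Then $$\mathbb E(\operatorname{adj}^r)=\sum_{m=2}^{\min(n,2r)}\ \sum_{u=1}^{\lfloor m/2\rfloor}\left(\left(\sum_{w=0}^{m-u}(-1)^w\binom{m-u}{w}(m-u-w)^r\right)\binom{m-u-1}{u-1}\,u!\,\frac{\binom{n-(m-u)}{u}^2}{n_{(m)}}\right).$$
   Context: For a permutation $\sigma=\sigma_1\cdots\sigma_n$ of $\{1,\dots,n\}$, $\operatorname{adj}(\sigma)$ is the number of indices $i\in\{1,\dots,n-1\}$ with $\sigma_i=\sigma_{i+1}+1$, i.e. descents in which the two entries have consecutive values. The expectation is with respect to the uniform distribution on the permutations of $\{1,\dots,n\}$. $n_{(m)}=n(n-1)\cdots(n-m+1)$ is the falling factorial. *)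

theory Defs
  imports "HOL-Probability.Probability" "HOL-Combinatorics.Permutations"
begin

(* A permutation of {1..n} is a function s with "s permutes {1..n}"; its one-line
   notation is s 1, ..., s n. *)

definition adj :: "nat \<Rightarrow> (nat \<Rightarrow> nat) \<Rightarrow> nat" where
  "adj n s = card {i \<in> {1..n - 1}. s i = s (i + 1) + 1}"

definition uniform_perm :: "nat \<Rightarrow> (nat \<Rightarrow> nat) pmf" where
  "uniform_perm n = pmf_of_set {s. s permutes {1..n}}"

definition falling_factorial :: "nat \<Rightarrow> nat \<Rightarrow> real" where
  "falling_factorial n m = (\<Prod>i<m. real n - real i)"

end

theory Submission
  imports Defs
begin

text \<open>
The moments are linear combinations of binomial moments, which can be counted exactly. Write
\<open>T r k\<close> for the alternating sum in the formula. It counts the surjections from an \<open>r\<close>-set onto a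
\<open>k\<close>-set, so sorting the maps from an \<open>r\<close>-set to an \<open>x\<close>-set by their image gives
\<open>x ^ r = (\<Sum>k\<le>r. T r k * (x choose k))\<close> (lemma \<open>power_eq_sum_surj_sum_binomial\<close>).

For \<open>x = adj n s\<close>, the number \<open>adj n s choose k\<close> counts the \<open>k\<close>-sets \<open>I\<close> of positions at each of
which \<open>s\<close> has an adjacency. Gluing the two entries of an adjacency into one entry turns a
permutation of length \<open>n\<close> into one of length \<open>n - 1\<close>, and nothing is lost as long as the position is
remembered. So exactly \<open>(n - k)!\<close> permutations have adjacencies at all positions of \<open>I\<close>, whatever
the shape of \<open>I\<close> (lemma \<open>card_perms_with_adj\<close>), and double counting gives the expectation
\<open>((n - 1) choose k) * (n - k)! / n!\<close> of \<open>adj n s choose k\<close>.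

The single sum over \<open>k\<close> so obtained becomes the double sum by splitting the \<open>k\<close>-sets of positions
according to the number \<open>u\<close> of their maximal runs of consecutive positions. With \<open>k\<close> adjacencies in
\<open>u\<close> runs, the entries involved number \<open>m = k + u\<close>, which is the outer index. On the level of
numbers this split is Vandermonde's identity (lemma \<open>choose_eq_sum_runs\<close>).
\<close>

section \<open>Powers in the binomial basis\<close>

text \<open>
By inclusion and exclusion this is the number of surjections from a set of size \<open>r\<close> onto a set of
size \<open>k\<close>. It is real-valued because the summands alternate in sign.
\<close>

definition surj_sum :: "nat \<Rightarrow> nat \<Rightarrow> real" where
  "surj_sum r k = (\<Sum>w = 0..k. (- 1) ^ w * real (k choose w) * real (k - w) ^ r)"

lemma surj_sum_0: "surj_sum 0 k = (if k = 0 then 1 else 0)"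
proof (cases "k = 0")
  case False
  then show ?thesis
    using choose_alternating_sum[of k, where 'a = real]
    by (simp add: surj_sum_def atMost_atLeast0)
qed (simp add: surj_sum_def)

lemma surj_sum_Suc_0: "surj_sum (Suc r) 0 = 0"
  by (simp add: surj_sum_def)

text \<open>
In terms of surjections: choose the image of the last element; the other \<open>r\<close> elements must cover
everything, or everything but that image. For the alternating sums, one factor of the power absorbs
into the binomial coefficient, and Pascal's rule then splits the remaining sum.
\<close>

lemma surj_sum_Suc_Suc:
  "surj_sum (Suc r) (Suc k) = real (Suc k) * (surj_sum r (Suc k) + surj_sum r k)"
proof -
  define A where "A = (\<Sum>w = 0..k. (- 1) ^ w * real (k choose w) * real (Suc k - w) ^ r)"
  have absorb: "real (Suc k choose w) * real (Suc k - w) = real (Suc k) * real (k choose w)"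
    if "w \<le> k" for w
  proof -
    have "(Suc k - w) * (Suc k choose w) = Suc k * (k choose w)"
      using binomial_absorb_comp[of "Suc k" w] by simp
    then show ?thesis
      by (metis mult.commute of_nat_mult)
  qed
  have "surj_sum (Suc r) (Suc k) =
      (\<Sum>w = 0..k. (- 1) ^ w * real (Suc k choose w) * real (Suc k - w) ^ Suc r)"
    by (simp add: surj_sum_def del: binomial_Suc_Suc)
  also have "\<dots> = (\<Sum>w = 0..k. real (Suc k) * ((- 1) ^ w * real (k choose w) * real (Suc k - w) ^ r))"
  proof (rule sum.cong[OF refl])
    fix w assume "w \<in> {0..k}"
    then have "real (Suc k choose w) * real (Suc k - w) = real (Suc k) * real (k choose w)"
      by (intro absorb) simp
    moreover have "(- 1) ^ w * real (Suc k choose w) * real (Suc k - w) ^ Suc r =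
        (- 1) ^ w * (real (Suc k choose w) * real (Suc k - w)) * real (Suc k - w) ^ r"
      by (simp only: power_Suc mult_ac)
    ultimately show "(- 1) ^ w * real (Suc k choose w) * real (Suc k - w) ^ Suc r =
        real (Suc k) * ((- 1) ^ w * real (k choose w) * real (Suc k - w) ^ r)"
      by (simp only: mult_ac)
  qed
  also have "\<dots> = real (Suc k) * A"
    by (simp only: A_def sum_distrib_left)
  also have "A = surj_sum r (Suc k) + surj_sum r k"
  proof -
    have "surj_sum r (Suc k) = real (Suc k) ^ r +
        (\<Sum>w = 0..k. (- 1) ^ Suc w * real (Suc k choose Suc w) * real (k - w) ^ r)"
      by (simp add: surj_sum_def sum.atLeast0_atMost_Suc_shift del: binomial_Suc_Suc sum.cl_ivl_Suc)
    also have "\<dots> = real (Suc k) ^ r +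
        (\<Sum>w = 0..k. (- 1) ^ Suc w * real (k choose Suc w) * real (k - w) ^ r) - surj_sum r k"
      by (simp add: surj_sum_def algebra_simps sum.distrib sum_negf sum_subtractf)
    also have "real (Suc k) ^ r +
        (\<Sum>w = 0..k. (- 1) ^ Suc w * real (k choose Suc w) * real (k - w) ^ r) =
        (\<Sum>w = 0..Suc k. (- 1) ^ w * real (k choose w) * real (Suc k - w) ^ r)"
      by (simp add: sum.atLeast0_atMost_Suc_shift del: sum.cl_ivl_Suc)
    also have "\<dots> = A"
      by (simp add: A_def)
    finally show ?thesis by simp
  qed
  finally show ?thesis .
qed

lemma surj_sum_eq_0: "r < k \<Longrightarrow> surj_sum r k = 0"
proof (induction r arbitrary: k)
  case 0
  then show ?case by (simp add: surj_sum_0)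
next
  case (Suc r)
  then show ?case by (cases k) (simp_all add: surj_sum_Suc_Suc)
qed

text \<open>
Multiplying \<open>x choose k\<close> by \<open>x = k + (x - k)\<close> gives
\<open>k * (x choose k) + (k + 1) * (x choose (k + 1))\<close>, and collecting the coefficients of the
\<open>x choose k\<close> reproduces the recurrence of \<open>surj_sum\<close>.
\<close>

lemma power_eq_sum_surj_sum_binomial:
  "real x ^ r = (\<Sum>k\<le>r. surj_sum r k * real (x choose k))"
proof (induction r)
  case 0
  then show ?case by (simp add: surj_sum_0)
next
  case (Suc r)
  have shift: "real x * real (x choose k) =
      real k * real (x choose k) + real (Suc k) * real (x choose Suc k)" for k
  proof (cases "k \<le> x")
    case True
    have "(x - k) * (x choose k) = Suc k * (x choose Suc k)"
      by (metis binomial_absorption binomial_absorb_comp)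
    then have "real (x - k) * real (x choose k) = real (Suc k) * real (x choose Suc k)"
      by (metis of_nat_mult)
    with True show ?thesis by (simp add: of_nat_diff algebra_simps)
  qed (simp add: binomial_eq_0)
  have "(\<Sum>k\<le>Suc r. surj_sum (Suc r) k * real (x choose k)) =
      (\<Sum>k\<le>r. surj_sum r (Suc k) * (real (Suc k) * real (x choose Suc k))) +
      (\<Sum>k\<le>r. surj_sum r k * (real (Suc k) * real (x choose Suc k)))"
    by (simp add: sum.atMost_Suc_shift surj_sum_Suc_0 surj_sum_Suc_Suc sum.distrib[symmetric]
        algebra_simps del: sum.atMost_Suc binomial_Suc_Suc of_nat_Suc)
  also have "(\<Sum>k\<le>r. surj_sum r (Suc k) * (real (Suc k) * real (x choose Suc k))) =
      (\<Sum>k\<le>Suc r. surj_sum r k * (real k * real (x choose k)))"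
    by (simp add: sum.atMost_Suc_shift del: sum.atMost_Suc binomial_Suc_Suc of_nat_Suc)
  also have "\<dots> = (\<Sum>k\<le>r. surj_sum r k * (real k * real (x choose k)))"
    by (simp add: surj_sum_eq_0)
  also have "\<dots> + (\<Sum>k\<le>r. surj_sum r k * (real (Suc k) * real (x choose Suc k))) =
      (\<Sum>k\<le>r. surj_sum r k * (real x * real (x choose k)))"
    by (simp only: sum.distrib[symmetric] distrib_left[symmetric] shift)
  also have "\<dots> = real x ^ Suc r"
    by (simp add: Suc.IH sum_distrib_left mult_ac)
  finally show ?case by simp
qed

section \<open>Permutations with prescribed adjacencies\<close>

definition perms_with_adj :: "nat \<Rightarrow> nat set \<Rightarrow> (nat \<Rightarrow> nat) set" where
  "perms_with_adj n I = {s. s permutes {1..n} \<and> (\<forall>i\<in>I. s i = s (i + 1) + 1)}"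

text \<open>
The map \<open>last_to N a\<close> and its inverse \<open>to_last N a\<close> are the cycles on \<open>a, \<dots>, N\<close>. Composed on the
value side of a permutation that fixes \<open>N\<close>, \<open>last_to N a\<close> raises the values from \<open>a\<close> on and makes
\<open>a\<close> the value of the last entry; composed on the position side, \<open>to_last N b\<close> then moves that entry
to position \<open>b\<close>. Cycles keep all functions permutations of the same set, so that inserting and
deleting an entry are plain compositions.
\<close>

definition last_to :: "nat \<Rightarrow> nat \<Rightarrow> nat \<Rightarrow> nat" where
  "last_to N a v = (if v = N then a else if a \<le> v \<and> v < N then v + 1 else v)"

definition to_last :: "nat \<Rightarrow> nat \<Rightarrow> nat \<Rightarrow> nat" where
  "to_last N a v = (if v = a then N else if a < v \<and> v \<le> N then v - 1 else v)"

lemma to_last_last_to: "a \<le> N \<Longrightarrow> to_last N a (last_to N a v) = v"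
  by (auto simp: to_last_def last_to_def)

lemma last_to_to_last: "a \<le> N \<Longrightarrow> last_to N a (to_last N a v) = v"
  by (auto simp: to_last_def last_to_def)

lemma last_to_permutes:
  assumes "a \<in> {1..N}"
  shows "last_to N a permutes {1..N}"
proof (rule bij_imp_permutes)
  show "bij_betw (last_to N a) {1..N} {1..N}"
    by (rule bij_betw_byWitness[where f' = "to_last N a"])
      (use assms in \<open>auto simp: to_last_def last_to_def\<close>)
qed (use assms in \<open>auto simp: last_to_def\<close>)

lemma to_last_permutes:
  assumes "a \<in> {1..N}"
  shows "to_last N a permutes {1..N}"
proof (rule bij_imp_permutes)
  show "bij_betw (to_last N a) {1..N} {1..N}"
    by (rule bij_betw_byWitness[where f' = "last_to N a"])
      (use assms in \<open>auto simp: to_last_def last_to_def\<close>)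
qed (use assms in \<open>auto simp: to_last_def\<close>)

text \<open>
An entry \<open>v\<close> at position \<open>i\<close> is split into the two entries \<open>v + 1, v\<close> at the positions \<open>i\<close> and
\<open>i + 1\<close>, while the larger values and the later positions move up by one. The inverse deletes the
entry at position \<open>i + 1\<close>. Since all positions in \<open>J\<close> come before \<open>i\<close>, neither step moves the
pairs of positions that \<open>J\<close> refers to, and no other entry has the value at which the values are
shifted, so the adjacencies at \<open>J\<close> survive in both directions.
\<close>

lemma bij_betw_split_entry:
  assumes J: "J \<subseteq> {1..<i}" and i: "i \<in> {1..n}"
  shows "bij_betw (\<lambda>t. last_to (Suc n) (t i) \<circ> t \<circ> to_last (Suc n) (Suc i))
    (perms_with_adj n J) (perms_with_adj (Suc n) (insert i J))"
proof (rule bij_betw_byWitness[where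
    f' = "\<lambda>s. to_last (Suc n) (s (Suc i)) \<circ> s \<circ> last_to (Suc n) (Suc i)"])
  let ?N = "Suc n"
  let ?f = "\<lambda>t. last_to ?N (t i) \<circ> t \<circ> to_last ?N (Suc i)"
  let ?g = "\<lambda>s. to_last ?N (s (Suc i)) \<circ> s \<circ> last_to ?N (Suc i)"
  have f_new: "?f t (Suc i) = t i" if "t \<in> perms_with_adj n J" for t
  proof -
    have "t permutes {1..n}" using that by (simp add: perms_with_adj_def)
    then have "t ?N = ?N" by (rule permutes_not_in) simp
    then show ?thesis by (simp add: to_last_def last_to_def)
  qed
  have f_low: "?f t j = last_to ?N (t i) (t j)" if "j \<le> i" for t j
    using that by (simp add: to_last_def)
  have g_low: "?g s j = to_last ?N (s (Suc i)) (s j)" if "j \<le> i" for s j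
    using that i by (simp add: last_to_def)
  have perm_range: "p k \<in> {1..m}" if "p permutes {1..m}" "k \<in> {1..m}" for p :: "nat \<Rightarrow> nat" and k m
    using permutes_in_image that by metis
  show "\<forall>t\<in>perms_with_adj n J. ?g (?f t) = t"
  proof (intro ballI ext)
    fix t x assume t: "t \<in> perms_with_adj n J"
    then have "t permutes {1..n}" by (simp add: perms_with_adj_def)
    then have "t i \<in> {1..n}" using i by (rule perm_range)
    then show "?g (?f t) x = t x"
      unfolding f_new[OF t] using i by (simp add: to_last_last_to)
  qed
  have s_adj: "s i = s (Suc i) + 1" if "s \<in> perms_with_adj ?N (insert i J)" for s
    using that by (simp add: perms_with_adj_def)
  have s_range: "s (Suc i) \<in> {1..n}" if s: "s \<in> perms_with_adj ?N (insert i J)" for s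
  proof -
    have p: "s permutes {1..?N}" using s by (simp add: perms_with_adj_def)
    have "s i \<in> {1..?N}" "s (Suc i) \<in> {1..?N}"
      by (rule perm_range[OF p]; use i in simp)+
    with s_adj[OF s] show ?thesis by auto
  qed
  have g_i: "?g s i = s (Suc i)" if s: "s \<in> perms_with_adj ?N (insert i J)" for s
    unfolding g_low[OF order_refl] s_adj[OF s] using s_range[OF s] by (simp add: to_last_def)
  show "\<forall>s\<in>perms_with_adj ?N (insert i J). ?f (?g s) = s"
  proof (intro ballI ext)
    fix s x assume s: "s \<in> perms_with_adj ?N (insert i J)"
    show "?f (?g s) x = s x"
      unfolding g_i[OF s] using s_range[OF s] i by (simp add: last_to_to_last)
  qed
  show "?f ` perms_with_adj n J \<subseteq> perms_with_adj ?N (insert i J)"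
  proof (rule image_subsetI)
    fix t assume t: "t \<in> perms_with_adj n J"
    then have p: "t permutes {1..n}" and adj: "\<And>j. j \<in> J \<Longrightarrow> t j = t (j + 1) + 1"
      by (auto simp: perms_with_adj_def)
    have ti: "t i \<in> {1..n}" using perm_range[OF p i] .
    have "?f t permutes {1..?N}"
      by (intro permutes_compose last_to_permutes to_last_permutes permutes_subset[OF p])
        (use ti i in auto)
    moreover have "?f t i = ?f t (i + 1) + 1"
      using f_new[OF t] f_low[of i t] ti by (simp add: last_to_def)
    moreover have "?f t j = ?f t (j + 1) + 1" if j: "j \<in> J" for j
    proof -
      have ji: "j \<le> i" "j + 1 \<le> i" and "j \<in> {1..n}" "j + 1 \<in> {1..n}" using J j i by auto
      then have "t j \<in> {1..n}" "t (j + 1) \<in> {1..n}" by (blast intro: perm_range[OF p])+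
      \<comment> \<open>Raising the values from \<open>t i\<close> on parts consecutive values only if the larger one is \<open>t i\<close>.\<close>
      moreover have "t j \<noteq> t i" using ji by (simp_all add: inj_eq[OF permutes_inj[OF p]])
      ultimately show ?thesis
        using adj[OF j] unfolding f_low[OF ji(1)] f_low[OF ji(2)]
        by (auto simp: last_to_def)
    qed
    ultimately show "?f t \<in> perms_with_adj ?N (insert i J)"
      unfolding perms_with_adj_def by blast
  qed
  show "?g ` perms_with_adj ?N (insert i J) \<subseteq> perms_with_adj n J"
  proof (rule image_subsetI)
    fix s assume s: "s \<in> perms_with_adj ?N (insert i J)"
    then have p: "s permutes {1..?N}" and adj: "\<And>j. j \<in> J \<Longrightarrow> s j = s (j + 1) + 1"
      by (auto simp: perms_with_adj_def)
    have "?g s permutes {1..?N}"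
      by (intro permutes_compose last_to_permutes to_last_permutes p)
        (use s_range[OF s] i in auto)
    then have "?g s permutes {1..n}"
    proof (rule permutes_superset)
      fix x assume "x \<in> {1..?N} - {1..n}"
      then have "x = ?N" by auto
      then show "?g s x = x" by (simp add: last_to_def to_last_def)
    qed
    moreover have "?g s j = ?g s (j + 1) + 1" if j: "j \<in> J" for j
    proof -
      have ji: "j \<le> i" "j + 1 \<le> i" and "j \<in> {1..?N}" "j + 1 \<in> {1..?N}" using J j i by auto
      then have "s j \<in> {1..?N}" "s (j + 1) \<in> {1..?N}" by (blast intro: perm_range[OF p])+
      \<comment> \<open>Consecutive values that both differ from the deleted value lie on the same side of it.\<close>
      moreover have "s j \<noteq> s (Suc i)" "s (j + 1) \<noteq> s (Suc i)"
        using ji by (simp_all add: inj_eq[OF permutes_inj[OF p]])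
      ultimately show ?thesis
        using adj[OF j] unfolding g_low[OF ji(1)] g_low[OF ji(2)]
        by (auto simp: to_last_def)
    qed
    ultimately show "?g s \<in> perms_with_adj n J"
      unfolding perms_with_adj_def by blast
  qed
qed

text \<open>
Gluing at the largest position of \<open>I\<close> first leaves all other positions of \<open>I\<close> in place, so the
induction on the size of \<open>I\<close> needs no renumbering.
\<close>

lemma card_perms_with_adj:
  assumes "I \<subseteq> {1..n - 1}"
  shows "card (perms_with_adj n I) = fact (n - card I)"
  using assms
proof (induction "card I" arbitrary: I n)
  case 0
  then have "I = {}" using finite_subset by fastforce
  then show ?case by (simp add: perms_with_adj_def card_permutations)
next
  case (Suc k)
  have fin: "finite I" using Suc.prems finite_subset by blast
  have "I \<noteq> {}" using Suc.hyps(2) by auto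
  define i where "i = Max I"
  have iI: "i \<in> I" unfolding i_def using fin \<open>I \<noteq> {}\<close> by simp
  have J: "I - {i} \<subseteq> {1..<i}"
  proof
    fix j assume "j \<in> I - {i}"
    then have "j \<le> i" "j \<noteq> i" "j \<in> I" unfolding i_def using fin by auto
    then show "j \<in> {1..<i}" using Suc.prems by auto
  qed
  have iN: "i \<in> {1..n - 1}" using iI Suc.prems by auto
  then obtain n' where n': "n = Suc n'" by (cases n) auto
  have "card (perms_with_adj n' (I - {i})) = card (perms_with_adj n (insert i (I - {i})))"
    unfolding n' by (rule bij_betw_same_card[OF bij_betw_split_entry[OF J]]) (use iN n' in auto)
  moreover have "insert i (I - {i}) = I" using iI by blast
  moreover have cJ: "k = card (I - {i})" using Suc.hyps(2) iI fin by simp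
  moreover have "I - {i} \<subseteq> {1..n' - 1}" using J iN n' by fastforce
  moreover have "n' - card (I - {i}) = n - card I" using cJ Suc.hyps(2) n' by simp
  ultimately show ?case
    using Suc.hyps(1)[OF cJ, of n'] by simp
qed

section \<open>Binomial moments of the number of adjacencies\<close>

text \<open>
Double counting of the pairs of a permutation and a \<open>k\<close>-set of positions where it has adjacencies.
\<close>

lemma sum_adj_choose:
  "(\<Sum>s | s permutes {1..n}. adj n s choose k) = ((n - 1) choose k) * fact (n - k)"
proof -
  let ?S = "{s. s permutes {1..n}}" and ?P = "{I. I \<subseteq> {1..n - 1} \<and> card I = k}"
  have finS: "finite ?S" by (simp add: finite_permutations)
  have finP: "finite ?P" by simp
  have choose: "adj n s choose k = card {I \<in> ?P. \<forall>i\<in>I. s i = s (i + 1) + 1}" for s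
  proof -
    have "adj n s choose k = card {I. I \<subseteq> {i \<in> {1..n - 1}. s i = s (i + 1) + 1} \<and> card I = k}"
      unfolding adj_def by (rule n_subsets[symmetric]) simp
    also have "{I. I \<subseteq> {i \<in> {1..n - 1}. s i = s (i + 1) + 1} \<and> card I = k} =
        {I \<in> ?P. \<forall>i\<in>I. s i = s (i + 1) + 1}" by blast
    finally show ?thesis .
  qed
  have "(\<Sum>s\<in>?S. adj n s choose k) = (\<Sum>s\<in>?S. card {I \<in> ?P. \<forall>i\<in>I. s i = s (i + 1) + 1})"
    by (simp only: choose)
  also have "\<dots> = (\<Sum>I\<in>?P. card {s \<in> ?S. \<forall>i\<in>I. s i = s (i + 1) + 1})"
    by (rule sum_multicount_gen[OF finS finP]) simp
  also have "\<dots> = (\<Sum>I\<in>?P. fact (n - k))"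
  proof (rule sum.cong[OF refl])
    fix I assume "I \<in> ?P"
    then show "card {s \<in> ?S. \<forall>i\<in>I. s i = s (i + 1) + 1} = fact (n - k)"
      using card_perms_with_adj[of I n] by (simp add: perms_with_adj_def)
  qed
  also have "\<dots> = ((n - 1) choose k) * fact (n - k)"
    using n_subsets[of "{1..n - 1}" k] by simp
  finally show ?thesis .
qed

lemma expectation_adj_power:
  "measure_pmf.expectation (uniform_perm n) (\<lambda>s. real (adj n s) ^ r) =
    (\<Sum>k\<le>r. surj_sum r k * real ((n - 1) choose k) * fact (n - k) / fact n)"
proof -
  let ?S = "{s. s permutes {1..n}}"
  have finS: "finite ?S" by (simp add: finite_permutations)
  have neS: "?S \<noteq> {}" using permutes_id by blast
  have cardS: "card ?S = fact n" by (simp add: card_permutations)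
  have "measure_pmf.expectation (uniform_perm n) (\<lambda>s. real (adj n s) ^ r) =
      (\<Sum>s\<in>?S. real (adj n s) ^ r) / fact n"
    unfolding uniform_perm_def integral_pmf_of_set[OF neS finS] cardS by (simp only: of_nat_fact)
  also have "(\<Sum>s\<in>?S. real (adj n s) ^ r) =
      (\<Sum>k\<le>r. \<Sum>s\<in>?S. surj_sum r k * real (adj n s choose k))"
    by (subst power_eq_sum_surj_sum_binomial) (rule sum.swap)
  also have "\<dots> = (\<Sum>k\<le>r. surj_sum r k * real (\<Sum>s\<in>?S. adj n s choose k))"
    by (simp add: sum_distrib_left)
  also have "\<dots> = (\<Sum>k\<le>r. surj_sum r k * real ((n - 1) choose k) * fact (n - k))"
    by (simp only: sum_adj_choose of_nat_mult of_nat_fact mult.assoc)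
  finally show ?thesis by (simp add: sum_divide_distrib)
qed

section \<open>Splitting by the number of runs\<close>

text \<open>
The left-hand side counts the \<open>k\<close>-subsets of \<open>n - 1\<close> positions. Those with \<open>u\<close> maximal runs
are given by a composition of \<open>k\<close> into \<open>u\<close> run lengths, in \<open>(k - 1) choose (u - 1)\<close> ways, and by
the choice of \<open>u\<close> of the \<open>n - k\<close> gaps around the \<open>n - 1 - k\<close> unused positions.
\<close>

lemma choose_eq_sum_runs:
  assumes "1 \<le> k"
  shows "(n - 1) choose k = (\<Sum>u = 1..k. ((k - 1) choose (u - 1)) * ((n - k) choose u))"
proof (cases "k \<le> n")
  case True
  have "(n - 1) choose k = (\<Sum>u\<le>k. ((n - k) choose u) * ((k - 1) choose (k - u)))"
    using vandermonde[of "n - k" "k - 1" k] assms True by simp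
  also have "\<dots> = (\<Sum>u = 1..k. ((n - k) choose u) * ((k - 1) choose (k - u)))"
    using assms by (intro sum.mono_neutral_right) (auto simp: binomial_eq_0 not_le)
  also have "\<dots> = (\<Sum>u = 1..k. ((k - 1) choose (u - 1)) * ((n - k) choose u))"
  proof (rule sum.cong[OF refl])
    fix u assume "u \<in> {1..k}"
    then have "u - 1 \<le> k - 1" and "k - 1 - (u - 1) = k - u"
      by auto
    from binomial_symmetric[OF this(1)] have "(k - 1) choose (k - u) = (k - 1) choose (u - 1)"
      unfolding \<open>k - 1 - (u - 1) = k - u\<close> by (rule sym)
    then show "((n - k) choose u) * ((k - 1) choose (k - u)) =
        ((k - 1) choose (u - 1)) * ((n - k) choose u)" by simp
  qed
  finally show ?thesis .
qed (simp add: binomial_eq_0)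

lemma falling_factorial_mult_fact:
  "m \<le> n \<Longrightarrow> falling_factorial n m * fact (n - m) = fact n"
proof (induction m)
  case 0
  then show ?case by (simp add: falling_factorial_def)
next
  case (Suc m)
  have "n - m = Suc (n - Suc m)" using Suc.prems by simp
  then have "fact (n - m) = (real n - real m) * fact (n - Suc m)"
    using Suc.prems by (simp add: of_nat_diff)
  with Suc show ?case by (simp add: falling_factorial_def mult_ac)
qed

lemma fact_choose_div_falling_factorial:
  assumes "k + u \<le> n"
  shows "fact u * (real ((n - k) choose u) ^ 2 / falling_factorial n (k + u)) =
    real ((n - k) choose u) * fact (n - k) / fact n"
proof -
  have "fact u * fact (n - k - u) * ((n - k) choose u) = fact (n - k)"
    using assms by (intro binomial_fact_lemma) simp
  then have "real (fact u * fact (n - k - u) * ((n - k) choose u)) = real (fact (n - k))"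
    by (simp only:)
  then have *: "fact (n - k) = fact u * fact (n - (k + u)) * real ((n - k) choose u)"
    by (simp add: diff_diff_left)
  have ff: "falling_factorial n (k + u) * fact (n - (k + u)) = fact n"
    by (rule falling_factorial_mult_fact[OF assms])
  then have "falling_factorial n (k + u) \<noteq> 0" by auto
  then show ?thesis
    unfolding * ff[symmetric] by (simp add: field_simps power2_eq_square)
qed

theorem theorem5p3:
  fixes n r :: nat
  assumes "r \<ge> 1"
  shows "measure_pmf.expectation (uniform_perm n) (\<lambda>s. real (adj n s) ^ r) =
    (\<Sum>m = 2..min n (2 * r). \<Sum>u = 1..m div 2.
       (\<Sum>w = 0..m - u. (- 1) ^ w * real ((m - u) choose w) * real (m - u - w) ^ r)
       * real ((m - u - 1) choose (u - 1)) * fact u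
       * (real ((n - (m - u)) choose u) ^ 2 / falling_factorial n m))"
proof -
  define G where "G k u = surj_sum r k * real ((k - 1) choose (u - 1)) *
    (real ((n - k) choose u) * fact (n - k) / fact n)" for k u
  define H where "H m u = surj_sum r (m - u) * real ((m - u - 1) choose (u - 1)) * fact u
    * (real ((n - (m - u)) choose u) ^ 2 / falling_factorial n m)" for m u
  let ?A = "SIGMA k:{1..r}. {1..k}"
  let ?B = "SIGMA m:{2..min n (2 * r)}. {1..m div 2}"
  have r0: "surj_sum r 0 = 0" using assms by (cases r) (auto simp: surj_sum_Suc_0)
  have H_G: "H (k + u) u = G k u" if "1 \<le> u" for k u
  proof (cases "k + u \<le> n")
    case True
    show ?thesis
      unfolding G_def H_def
      by (simp only: add_diff_cancel_right' mult.assoc fact_choose_div_falling_factorial[OF True])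
  next
    case False
    with that have "n - k < u" by simp
    then show ?thesis by (simp add: G_def H_def binomial_eq_0)
  qed
  have "measure_pmf.expectation (uniform_perm n) (\<lambda>s. real (adj n s) ^ r) =
      (\<Sum>k\<le>r. surj_sum r k * real ((n - 1) choose k) * fact (n - k) / fact n)"
    by (rule expectation_adj_power)
  also have "\<dots> = (\<Sum>k = 1..r.
      surj_sum r k * real ((n - 1) choose k) * fact (n - k) / fact n)"
  proof (rule sum.mono_neutral_right)
    show "\<forall>k\<in>{..r} - {1..r}.
        surj_sum r k * real ((n - 1) choose k) * fact (n - k) / fact n = 0"
    proof
      fix k assume "k \<in> {..r} - {1..r}"
      then have "k = 0" by auto
      then show "surj_sum r k * real ((n - 1) choose k) * fact (n - k) / fact n = 0"
        by (simp add: r0)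
    qed
  qed auto
  also have "\<dots> = (\<Sum>k = 1..r. \<Sum>u = 1..k. G k u)"
  proof (rule sum.cong[OF refl])
    fix k assume "k \<in> {1..r}"
    then have "(n - 1) choose k = (\<Sum>u = 1..k. ((k - 1) choose (u - 1)) * ((n - k) choose u))"
      by (intro choose_eq_sum_runs) auto
    then show "surj_sum r k * real ((n - 1) choose k) * fact (n - k) / fact n = (\<Sum>u = 1..k. G k u)"
      by (simp add: G_def sum_distrib_left sum_distrib_right sum_divide_distrib mult_ac)
  qed
  also have "\<dots> = (\<Sum>(k, u)\<in>?A. G k u)"
    by (rule sum.Sigma) auto
  \<comment> \<open>Under \<open>m = k + u\<close> the index sets agree only up to zero terms. Pairs with \<open>k + u > n\<close> ask for
    more runs than there are gaps; those with \<open>k = m - u > r\<close> allow no surjection. A pair with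
    \<open>k \<le> r\<close> has \<open>m \<le> 2 * r\<close> because \<open>u \<le> k\<close>.\<close>
  also have "\<dots> = (\<Sum>(m, u)\<in>?B. H m u)"
  proof (rule sum.reindex_bij_witness_not_neutral[where
        i = "\<lambda>(m, u). (m - u, u)" and j = "\<lambda>(k, u). (k + u, u)"
        and S' = "{(k, u) \<in> ?A. n < k + u}" and T' = "{(m, u) \<in> ?B. r < m - u}"])
    show "finite {(k, u) \<in> ?A. n < k + u}" "finite {(m, u) \<in> ?B. r < m - u}"
      by (rule finite_subset[of _ ?A], auto) (rule finite_subset[of _ ?B], auto)
  next
    fix p assume "p \<in> {(k, u) \<in> ?A. n < k + u}"
    then show "(case p of (k, u) \<Rightarrow> G k u) = 0"
      by (auto simp: G_def binomial_eq_0)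
  next
    fix q assume "q \<in> {(m, u) \<in> ?B. r < m - u}"
    then show "(case q of (m, u) \<Rightarrow> H m u) = 0"
      by (auto simp: H_def surj_sum_eq_0)
  next
    fix p assume "p \<in> ?A"
    then show "(case (case p of (k, u) \<Rightarrow> (k + u, u)) of (m, u) \<Rightarrow> H m u) = (case p of (k, u) \<Rightarrow> G k u)"
      by (cases p) (simp add: H_G)
  qed auto
  also have "\<dots> = (\<Sum>m = 2..min n (2 * r). \<Sum>u = 1..m div 2. H m u)"
    by (rule sum.Sigma[symmetric]) auto
  finally show ?thesis
    unfolding H_def surj_sum_def .
qed

end
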